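(* (1) Let $(\mathbb{T},K)$ be either (Sacks case) $\mathbb{T}$ = the family of all Sacks trees and $K=\{0,1\}$, or (Laver case) $\mathbb{T}$ = the family of all Laver trees and $K=\omega$; let $(t)$-sets, $(t^0)$-sets and the family $\mathbb{T}^0$ be those determined by $\mathbb{T}$. Let $A\in P(K^\omega)\setminus\mathbb{T}^0$ and let $\mathcal{F}$ be a point-finite cover of $A$ consisting of $(t^0)$-sets. Suppose that for each $T\in\mathbb{T}$ with $A\cap[T]\neq\emptyset$ there exists $Q\in\mathbb{T}$, $Q\leqslant T$, with $A\cap[Q]\neq\emptyset$, such that the family $\mathcal{F}_{[Q]}=\{F\cap[Q]: F\in\mathcal{F}\}$ has cardinality continuum. Then there exist such a $Q$ (that is, $Q\in\mathbb{T}$ with $A\cap[Q]\neq\emptyset$ and $|\mathcal{F}_{[Q]}|=2^{\aleph_0}$) and a subfamily $\mathcal{F}'\subseteq\mathcal{F}$ such that $\bigcup\mathcal{F}'_{[Q]}$ is not a $(t)$-set, where $\mathcal{F}'_{[Q]}=\{F\cap[Q]: F\in\mathcal{F}'\}$. (2) Let $M\in P([\omega]^\omega)\setminus\mathbb{NR}$ and let $\mathcal{F}$ be a point-finite cover of $M$ consisting of $NR$-sets. Suppose that for each $EL$-set $[a,A]$ with $M\cap[a,A]\neq\emptyset$ there exists an $EL$-set $[b,B]\subseteq[a,A]$ with $M\cap[b,B]\neq\emptyset$ such that the family $\mathcal{F}_{[b,B]}=\{F\cap[b,B]: F\in\mathcal{F}\}$ has cardinality continuum. Then there exist such a $[b,B]$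 (that is, an $EL$-set with $M\cap[b,B]\neq\emptyset$ and $|\mathcal{F}_{[b,B]}|=2^{\aleph_0}$) and a subfamily $\mathcal{F}'\subseteq\mathcal{F}$ such that $\bigcup\mathcal{F}'_{[b,B]}$ is not a $CR$-set, where $\mathcal{F}'_{[b,B]}=\{F\cap[b,B]: F\in\mathcal{F}'\}$.
   Context: Trees. For $K\subseteq\omega$, a (nonempty) set $T\subseteq K^{<\omega}$ is a tree if it is closed under initial segments; trees are assumed to have no terminal nodes. For $t\in T$, $split(t,T)=|\{n\in K: \text{the concatenation of } t \text{ with } (n) \text{ is in } T\}|$. A tree $T$ is a Sacks (perfect) tree if $K=\{0,1\}$ and for each $t\in T$ there is $s\in T$ with $t\subseteq s$ and $split(s,T)=2$. A tree $T$ is a Laver tree if $K=\omega$ and there is $s\in T$ (the stem) such that for each $t\in T$ either $t\subseteq s$ or $s\subseteq t$, and $split(t,T)$ is infinite for each $t\in T$ with $s\subseteq t$. The set of infinite paths is $[T]=\{x\in K^\omega: x\upharpoonright n\in T \text{ for all } n\in\omega\}$. For trees $Q,T\in\mathbb{T}$, $Q\leqslant T$ means $Q\subseteq T$. A set $X\subseteq K^\omega$ is a $(t)$-set if for every $T\in\mathbb{T}$ there is $Q\in\mathbb{T}$ with $Q\subseteq T$ and ($[Q]\subseteq X$ or $[Q]\cap X=\emptyset$). It is a $(t^0)$-set if for every $T\in\mathbb{T}$ there is $Q\in\mathbb{T}$ with $Q\subseteq T$ and $[Q]\cap X=\emptyset$. $\mathbb{T}^0$ denotes the family of all $(t^0)$-sets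 in $K^\omega$. Ellentuck structure. $[\omega]^\omega$ is the set of infinite subsets of $\omega$, $[\omega]^{<\omega}$ the set of finite subsets, and $[A]^\omega$ the set of infinite subsets of $A$. For $a\in[\omega]^{<\omega}$ and $A\in[\omega]^\omega$ let $[a,A]=\{B\in[\omega]^\omega: a\subset B\subseteq a\cup A\}$; such sets are called $EL$-sets. A set $M\subseteq[\omega]^\omega$ is a $CR$-set (completely Ramsey) if for every $[a,A]$ there is $B\in[A]^\omega$ with $[a,B]\subseteq M$ or $[a,B]\cap M=\emptyset$. It is an $NR$-set (Ramsey null) if for every $[a,A]$ there is $B\in[A]^\omega$ with $[a,B]\cap M=\emptyset$. $\mathbb{NR}$ denotes the family of all $NR$-sets. Point-finite covers. A family $\mathcal{A}\subseteq P(X)$ is a point-finite cover of a set $X$ if $\bigcup\mathcal{A}=X$ and $\{C\in\mathcal{A}: x\in C\}$ is finite for each $x\in X$. *)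

theory Defs
  imports Main "HOL-Library.Sublist" "HOL-Library.FuncSet" "HOL-Library.Equipollence"
begin

text \<open>
  Nodes are lists of natural numbers: \<open>lists K\<close> is the set of finite sequences and
  \<open>UNIV \<rightarrow> K\<close> the set of infinite sequences over \<open>K\<close>. End-extension \<open>t \<subseteq> s\<close> of
  sequences is \<open>prefix t s\<close>, and concatenation of \<open>t\<close> with \<open>(n)\<close> is \<open>t @ [n]\<close>.
\<close>

definition successors :: "nat set \<Rightarrow> nat list \<Rightarrow> nat list set \<Rightarrow> nat set" where
  "successors K t T = {n \<in> K. t @ [n] \<in> T}"

definition is_tree :: "nat set \<Rightarrow> nat list set \<Rightarrow> bool" where
  "is_tree K T \<longleftrightarrow>
     T \<noteq> {} \<and> T \<subseteq> lists K \<and>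
     (\<forall>t\<in>T. \<forall>s. prefix s t \<longrightarrow> s \<in> T) \<and>
     (\<forall>t\<in>T. successors K t T \<noteq> {})"

definition sacks_trees :: "nat list set set" where
  "sacks_trees =
     {T. is_tree {0, 1} T \<and> (\<forall>t\<in>T. \<exists>s\<in>T. prefix t s \<and> card (successors {0, 1} s T) = 2)}"

definition laver_trees :: "nat list set set" where
  "laver_trees =
     {T. is_tree UNIV T \<and>
         (\<exists>s\<in>T. (\<forall>t\<in>T. prefix t s \<or> prefix s t) \<and>
                (\<forall>t\<in>T. prefix s t \<longrightarrow> infinite (successors UNIV t T)))}"

definition paths :: "nat set \<Rightarrow> nat list set \<Rightarrow> (nat \<Rightarrow> nat) set" where
  "paths K T = {x \<in> UNIV \<rightarrow> K. \<forall>n. map x [0..<n] \<in> T}"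

definition t_sets :: "nat list set set \<Rightarrow> nat set \<Rightarrow> (nat \<Rightarrow> nat) set set" where
  "t_sets \<T> K =
     {X. X \<subseteq> (UNIV \<rightarrow> K) \<and>
         (\<forall>T\<in>\<T>. \<exists>Q\<in>\<T>. Q \<subseteq> T \<and> (paths K Q \<subseteq> X \<or> paths K Q \<inter> X = {}))}"

definition t0_sets :: "nat list set set \<Rightarrow> nat set \<Rightarrow> (nat \<Rightarrow> nat) set set" where
  "t0_sets \<T> K =
     {X. X \<subseteq> (UNIV \<rightarrow> K) \<and>
         (\<forall>T\<in>\<T>. \<exists>Q\<in>\<T>. Q \<subseteq> T \<and> paths K Q \<inter> X = {})}"

definition inf_subsets :: "nat set \<Rightarrow> nat set set" where
  "inf_subsets A = {B. B \<subseteq> A \<and> infinite B}"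

definition ellentuck :: "nat set \<Rightarrow> nat set \<Rightarrow> nat set set" where
  "ellentuck a A = {B \<in> inf_subsets UNIV. a \<subset> B \<and> B \<subseteq> a \<union> A}"

definition EL_sets :: "nat set set set" where
  "EL_sets = {ellentuck a A | a A. finite a \<and> infinite A}"

definition CR_sets :: "nat set set set" where
  "CR_sets =
     {M. M \<subseteq> inf_subsets UNIV \<and>
         (\<forall>a A. finite a \<and> infinite A \<longrightarrow>
            (\<exists>B \<in> inf_subsets A. ellentuck a B \<subseteq> M \<or> ellentuck a B \<inter> M = {}))}"

definition NR_sets :: "nat set set set" where
  "NR_sets =
     {M. M \<subseteq> inf_subsets UNIV \<and>
         (\<forall>a A. finite a \<and> infinite A \<longrightarrow>
            (\<exists>B \<in> inf_subsets A. ellentuck a B \<inter> M = {}))}"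

definition point_finite_cover :: "'a set set \<Rightarrow> 'a set \<Rightarrow> bool" where
  "point_finite_cover \<A> X \<longleftrightarrow> \<Union>\<A> = X \<and> (\<forall>x\<in>X. finite {C \<in> \<A>. x \<in> C})"

definition restrict_family :: "'a set set \<Rightarrow> 'a set \<Rightarrow> 'a set set" where
  "restrict_family \<F> Y = {F \<inter> Y | F. F \<in> \<F>}"

definition card_continuum :: "'a set \<Rightarrow> bool" where
  "card_continuum S \<longleftrightarrow> S \<approx> (UNIV :: nat set set)"

end

theory Submission
  imports Defs
begin

text \<open>
  Call an element of \<open>\<T>\<close>, or an EL-set, a condition. A set outside the ideal meets every
  condition below some condition \<open>e\<close>. For trees this is the definition of the ideal; for the
  Ramsey null sets it is the theorem that sets which are nowhere dense in the Ellentuck topology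
  are Ramsey null (\<open>dense_in_some_EL_set\<close>), proved by an accept-reject argument with two fusions.

  By hypothesis there is a condition \<open>d\<close> below \<open>e\<close> with continuum many traces, and, since all
  conditions below \<open>d\<close> meet the covered set, each of them meets continuum many members of
  \<open>\<F>\<close>. There are at most continuum many conditions, so pairwise distinct members
  \<open>f (p, i)\<close> of \<open>\<F>\<close> can be chosen that meet the condition \<open>p\<close>, for all conditions \<open>p\<close> below \<open>d\<close>
  and all natural numbers \<open>i\<close> (\<open>injective_choice\<close>). Let \<open>U i\<close> be the union of the sets
  \<open>f (p, i)\<close> over all \<open>p\<close>, cut down to \<open>d\<close>. It meets every condition below \<open>d\<close>. If it is
  measurable (a \<open>(t)\<close>-set or a CR-set), then every condition below \<open>d\<close> therefore contains one that is
  included in \<open>U i\<close>. If this holds for all \<open>i\<close>, a decreasing sequence of conditions with growing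
  stems gives a point of all the sets \<open>U i\<close> (\<open>point_catching_trees\<close>, \<open>point_catching_EL\<close>). That
  point lies in infinitely many members of \<open>\<F>\<close>, contrary to point-finiteness. So some
  \<open>U i\<close> is not measurable (\<open>undecided_subfamily_union\<close>).
\<close>

section \<open>Cardinality\<close>

text \<open>Well-order the index set in its cardinal order type. Fewer than \<open>|I|\<close> values have been
  used before stage \<open>i\<close>, so the set \<open>S i\<close> still contains a fresh one.\<close>

lemma injective_choice:
  assumes large: "\<And>i. i \<in> I \<Longrightarrow> I \<lesssim> S i"
  shows "\<exists>f. inj_on f I \<and> (\<forall>i\<in>I. f i \<in> S i)"
proof -
  define r where "r = card_of I"
  have wo: "well_order_on I r" and Fr: "Field r = I" and co: "Card_order r"
    by (simp_all add: r_def card_of_well_order_on Field_card_of card_of_card_order_on)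
  have wf: "wf (r - Id)"
    using wo by (simp add: well_order_on_def)
  define P where "P = (\<lambda>f i x. i \<in> I \<longrightarrow> x \<in> S i - f ` underS r i)"
  have "\<exists>f. \<forall>i. P f i (f i)"
  proof (rule dependent_wf_choice[OF wf])
    fix f g :: "'a \<Rightarrow> 'b" and i x
    assume "\<And>j. (j, i) \<in> r - Id \<Longrightarrow> f j = g j"
    then have "f ` underS r i = g ` underS r i"
      by (intro image_cong) (auto simp: underS_def)
    then show "P f i x = P g i x" by (simp add: P_def)
  next
    fix i and f :: "'a \<Rightarrow> 'b"
    show "\<exists>x. P f i x"
    proof (cases "i \<in> I")
      case True
      have "\<not> S i \<subseteq> f ` underS r i"
      proof
        assume "S i \<subseteq> f ` underS r i"
        then have "I \<lesssim> underS r i"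
          using large[OF True] subset_image_lepoll lepoll_trans by blast
        then have "ordLeq3 (card_of I) (card_of (underS r i))"
          by (simp add: lepoll_def card_of_ordLeq)
        moreover have "ordLess2 (card_of (underS r i)) (card_of I)"
          using card_of_underS[OF co, of i] True Fr by (simp add: r_def)
        ultimately show False using not_ordLess_ordLeq by blast
      qed
      then show ?thesis by (auto simp: P_def)
    qed (simp add: P_def)
  qed
  then obtain f where f: "\<And>i. i \<in> I \<Longrightarrow> f i \<in> S i - f ` underS r i"
    by (auto simp: P_def)
  have "inj_on f I"
  proof (rule inj_onI, rule ccontr)
    fix i j assume ij: "i \<in> I" "j \<in> I" "f i = f j" "i \<noteq> j"
    have "total_on I r"
      using wo by (simp add: well_order_on_def linear_order_on_def)
    with ij have "i \<in> underS r j \<or> j \<in> underS r i"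
      by (auto simp: total_on_def underS_def)
    with f ij show False by (metis DiffD2 imageI)
  qed
  with f show ?thesis by blast
qed

text \<open>The hypothesis of the theorem counts the distinct traces \<open>F \<inter> Y\<close>, and one of these may be
  empty. Choosing a set for every nonempty trace counts members of the family instead, and these
  still meet every larger set \<open>Z\<close>.\<close>

lemma continuum_many_sets_meet:
  assumes "card_continuum (restrict_family \<F> Y)" and "Y \<subseteq> Z"
  shows "(UNIV :: nat set set) \<lesssim> {F \<in> \<F>. F \<inter> Z \<noteq> {}}"
proof -
  let ?R = "restrict_family \<F> Y"
  have c: "(UNIV :: nat set set) \<approx> ?R"
    using assms(1) by (simp add: card_continuum_def eqpoll_sym)
  then have "infinite (?R - {{}})"
    by (metis Finite_Set.finite_set eqpoll_finite_iff finite_Diff2 finite_insert finite.emptyI infinite_UNIV_nat)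
  then have "insert {} (?R - {{}}) \<lesssim> ?R - {{}}"
    by (rule eqpoll_imp_lepoll[OF infinite_insert_eqpoll])
  moreover have "?R \<lesssim> insert {} (?R - {{}})"
    by (rule subset_imp_lepoll) blast
  moreover have "?R - {{}} \<lesssim> {F \<in> \<F>. F \<inter> Z \<noteq> {}}"
    using assms(2) by (intro subset_image_lepoll[where f = "\<lambda>F. F \<inter> Y"])
      (auto simp: restrict_family_def image_iff)
  ultimately show ?thesis
    using c lepoll_trans lepoll_trans1 by blast
qed

lemma Union_restrict_family: "\<Union>(restrict_family \<F> Y) = \<Union>\<F> \<inter> Y"
  by (auto simp: restrict_family_def)

lemma times_nat_lepoll_continuum:
  assumes "P \<lesssim> (UNIV :: nat set set)"
  shows "P \<times> (UNIV :: nat set) \<lesssim> (UNIV :: nat set set)"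
proof -
  have odd_member: "2 * k + 1 \<in> insert (2 * m) ((\<lambda>k. 2 * k + 1) ` X) \<longleftrightarrow> k \<in> X"
    for k m :: nat and X
  proof -
    have "2 * k + 1 \<noteq> 2 * m" by presburger
    then show ?thesis by auto
  qed
  have "inj (\<lambda>(X :: nat set, n). insert (2 * n) ((\<lambda>k. 2 * k + 1) ` X))"
  proof (rule injI, clarify)
    fix X Y :: "nat set" and m n
    assume eq: "insert (2 * m) ((\<lambda>k. 2 * k + 1) ` X) = insert (2 * n) ((\<lambda>k. 2 * k + 1) ` Y)"
    have "2 * m = 2 * n"
    proof -
      have "2 * m \<in> insert (2 * n) ((\<lambda>k. 2 * k + 1) ` Y)" using eq by blast
      then show ?thesis by auto presburger
    qed
    moreover have "k \<in> X \<longleftrightarrow> k \<in> Y" for k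
      using odd_member[of k m X] odd_member[of k n Y] unfolding eq by blast
    ultimately show "X = Y \<and> m = n" by auto
  qed
  then have "(UNIV :: (nat set \<times> nat) set) \<lesssim> (UNIV :: nat set set)"
    unfolding lepoll_def by blast
  moreover have "P \<times> (UNIV :: nat set) \<lesssim> (UNIV :: nat set set) \<times> (UNIV :: nat set)"
    using assms by (intro times_lepoll_mono) auto
  ultimately show ?thesis using lepoll_trans by force
qed

section \<open>Undecided unions in notions of forcing\<close>

text \<open>A Baire category property of a notion of forcing whose conditions \<open>p\<close> have bodies of points:
  countably many sets, each containing the body of a condition below every given condition, have a
  common point. For trees the body of a tree is its set of paths, and an EL-set is its own body.\<close>

definition point_catching :: "'s set set \<Rightarrow> ('s set \<Rightarrow> 'x set) \<Rightarrow> bool" where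
  "point_catching P body \<longleftrightarrow>
     (\<forall>d\<in>P. \<forall>U :: nat \<Rightarrow> 'x set.
        (\<forall>i. \<forall>p\<in>P. p \<subseteq> d \<longrightarrow> (\<exists>q\<in>P. q \<subseteq> p \<and> body q \<subseteq> U i)) \<longrightarrow> (\<Inter>i. U i) \<noteq> {})"

text \<open>The common core of the Sacks, the Laver and the Ellentuck case. The family \<open>\<F>'\<close> is one of
  countably many disjoint subfamilies, each chosen so that its union meets every body below \<open>d\<close>.
  If each of these unions contained a body below every condition below \<open>d\<close>, then some point would
  lie in all of them, hence in infinitely many members of a point-finite family.\<close>

theorem undecided_subfamily_union:
  fixes P :: "'s set set" and body :: "'s set \<Rightarrow> 'x set"
  assumes mono: "mono body"
    and small: "P \<lesssim> (UNIV :: nat set set)"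
    and catch: "point_catching P body"
    and cover: "point_finite_cover \<F> A"
    and e: "e \<in> P" and dense: "\<forall>p\<in>P. p \<subseteq> e \<longrightarrow> A \<inter> body p \<noteq> {}"
    and rich: "\<forall>p\<in>P. A \<inter> body p \<noteq> {} \<longrightarrow>
      (\<exists>q\<in>P. q \<subseteq> p \<and> A \<inter> body q \<noteq> {} \<and> card_continuum (restrict_family \<F> (body q)))"
  shows "\<exists>d\<in>P. A \<inter> body d \<noteq> {} \<and> card_continuum (restrict_family \<F> (body d)) \<and>
    (\<exists>\<F>'\<subseteq>\<F>. \<exists>p\<in>P. p \<subseteq> d \<and> (\<forall>q\<in>P. q \<subseteq> p \<longrightarrow>
       \<not> body q \<subseteq> \<Union>(restrict_family \<F>' (body d)) \<and>
       body q \<inter> \<Union>(restrict_family \<F>' (body d)) \<noteq> {}))"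
proof -
  have "A \<inter> body e \<noteq> {}" using dense e by simp
  then obtain d where d: "d \<in> P" "d \<subseteq> e" "A \<inter> body d \<noteq> {}"
    "card_continuum (restrict_family \<F> (body d))"
    using rich e by meson
  \<comment> \<open>the sets \<open>f (p, i)\<close> found below are pairwise distinct; the second index separates the subfamilies\<close>
  define D where "D = {p \<in> P. p \<subseteq> d}"
  define S where "S = (\<lambda>(p, i::nat). {F \<in> \<F>. F \<inter> body p \<noteq> {}})"
  have "D \<lesssim> (UNIV :: nat set set)"
    using small subset_imp_lepoll[of D P] lepoll_trans by (auto simp: D_def)
  then have "D \<times> (UNIV :: nat set) \<lesssim> (UNIV :: nat set set)"
    by (rule times_nat_lepoll_continuum)
  moreover have "(UNIV :: nat set set) \<lesssim> S x" if "x \<in> D \<times> UNIV" for x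
  proof -
    obtain p i where x: "x = (p, i)" by (cases x)
    with that have p: "p \<in> P" "p \<subseteq> d" by (auto simp: D_def)
    obtain q where "q \<subseteq> p" "card_continuum (restrict_family \<F> (body q))"
      using rich[rule_format, of p] dense[rule_format, of p] d(2) p by (meson subset_trans)
    then show ?thesis
      using continuum_many_sets_meet[of \<F> "body q" "body p"] monoD[OF mono] x by (simp add: S_def)
  qed
  ultimately obtain f where inj: "inj_on f (D \<times> UNIV)" and f: "\<And>x. x \<in> D \<times> UNIV \<Longrightarrow> f x \<in> S x"
    using injective_choice[of "D \<times> UNIV" S] lepoll_trans by blast
  have f_in: "f (p, i) \<in> \<F>" and f_meets: "f (p, i) \<inter> body p \<noteq> {}" if "p \<in> D" for p i
    using f[of "(p, i)"] that by (auto simp: S_def)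
  define G where "G = (\<lambda>i. (\<lambda>p. f (p, i)) ` D)"
  define U where "U = (\<lambda>i. \<Union>(restrict_family (G i) (body d)))"
  have U: "U i = \<Union>(G i) \<inter> body d" for i
    by (simp add: U_def Union_restrict_family)
  have meets: "body q \<inter> U i \<noteq> {}" if "q \<in> D" for q i
    using f_meets[OF that, of i] monoD[OF mono, of q d] that unfolding U G_def D_def by blast
  have "(\<Inter>i. U i) = {}"
  proof (rule ccontr)
    assume "(\<Inter>i. U i) \<noteq> {}"
    then obtain x where "\<forall>i. x \<in> \<Union>(G i)" by (auto simp: U)
    then have "\<forall>i. \<exists>p. p \<in> D \<and> x \<in> f (p, i)" by (auto simp: G_def)
    then obtain p where p: "\<And>i. p i \<in> D" "\<And>i. x \<in> f (p i, i)" by metis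
    \<comment> \<open>different \<open>i\<close> give different members of \<open>\<F>\<close> although the conditions \<open>p i\<close> may coincide\<close>
    have "inj (\<lambda>i. f (p i, i))"
      using p(1) by (auto intro!: injI dest!: inj_onD[OF inj])
    then have "infinite (range (\<lambda>i. f (p i, i)))" by (simp add: range_inj_infinite)
    moreover have "range (\<lambda>i. f (p i, i)) \<subseteq> {F \<in> \<F>. x \<in> F}" using p f_in by auto
    moreover have "x \<in> A" using cover p f_in unfolding point_finite_cover_def by blast
    ultimately show False
      using cover finite_subset[of "range (\<lambda>i. f (p i, i))" "{F \<in> \<F>. x \<in> F}"]
      unfolding point_finite_cover_def by simp
  qed
  then have "\<not> (\<forall>i. \<forall>p\<in>P. p \<subseteq> d \<longrightarrow> (\<exists>q\<in>P. q \<subseteq> p \<and> body q \<subseteq> U i))"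
    using catch[unfolded point_catching_def, THEN bspec, OF d(1), THEN spec, of U] by argo
  then obtain i p where p: "p \<in> P" "p \<subseteq> d"
    "\<forall>q\<in>P. q \<subseteq> p \<longrightarrow> \<not> body q \<subseteq> U i"
    by blast
  have "\<forall>q\<in>P. q \<subseteq> p \<longrightarrow>
       \<not> body q \<subseteq> \<Union>(restrict_family (G i) (body d)) \<and>
       body q \<inter> \<Union>(restrict_family (G i) (body d)) \<noteq> {}"
    using p(2,3) meets[of _ i] by (simp add: U_def D_def)
  moreover have "G i \<subseteq> \<F>" using f_in by (auto simp: G_def)
  ultimately show ?thesis using d p(1,2) by blast
qed

section \<open>Sacks and Laver trees\<close>

definition tree_below :: "nat list \<Rightarrow> nat list set \<Rightarrow> nat list set" where
  "tree_below t T = {s \<in> T. prefix s t \<or> prefix t s}"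

lemma in_tree_below: "s \<in> tree_below t T \<longleftrightarrow> s \<in> T \<and> (prefix s t \<or> prefix t s)"
  by (simp add: tree_below_def)

lemma successors_tree_below:
  assumes "prefix t s"
  shows "successors K s (tree_below t T) = successors K s T"
  using assms by (auto simp: successors_def tree_below_def prefix_def)

lemma is_tree_tree_below:
  assumes T: "is_tree K T" and t: "t \<in> T"
  shows "is_tree K (tree_below t T)"
  unfolding is_tree_def
proof (intro conjI ballI allI impI)
  show "tree_below t T \<noteq> {}" using t by (auto simp: tree_below_def)
  show "tree_below t T \<subseteq> lists K" using T by (auto simp: tree_below_def is_tree_def)
  fix s assume s: "s \<in> tree_below t T"
  show "u \<in> tree_below t T" if "prefix u s" for u
    using s that T prefix_same_cases[of u s t] prefix_order.trans[of u s t]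
    unfolding tree_below_def is_tree_def by blast
  show "successors K s (tree_below t T) \<noteq> {}"
  proof (cases "prefix t s")
    case True
    then show ?thesis
      using T s by (auto simp: successors_tree_below in_tree_below is_tree_def)
  next
    case False
    then obtain n us where eq: "t = s @ n # us"
      using s by (auto simp: tree_below_def prefix_def) (metis append.right_neutral neq_Nil_conv)
    then have "s @ [n] \<in> T" "n \<in> K"
      using T t by (auto simp: is_tree_def)
    then show ?thesis
      using eq by (auto simp: successors_def tree_below_def)
  qed
qed

lemma tree_below_sacks:
  assumes T: "T \<in> sacks_trees" and t: "t \<in> T"
  shows "tree_below t T \<in> sacks_trees"
  unfolding sacks_trees_def
proof (intro CollectI conjI ballI)
  show "is_tree {0, 1} (tree_below t T)"
    using T t by (auto simp: sacks_trees_def intro: is_tree_tree_below)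
  fix s assume s: "s \<in> tree_below t T"
  then have *: "\<exists>u\<in>T. prefix t u \<and> prefix s u"
    using t by (auto simp: tree_below_def)
  then obtain u where u: "u \<in> T" "prefix t u" "prefix s u" by blast
  with T obtain v where "v \<in> T" "prefix u v" "card (successors {0, 1} v T) = 2"
    by (auto simp: sacks_trees_def)
  moreover from this u have "prefix t v" "prefix s v" by (auto intro: prefix_order.trans)
  ultimately show "\<exists>v\<in>tree_below t T. prefix s v \<and> card (successors {0, 1} v (tree_below t T)) = 2"
    by (intro bexI[of _ v]) (auto simp: successors_tree_below in_tree_below)
qed

text \<open>The stem of the restricted tree is the longer of \<open>t\<close> and the old stem; if \<open>t\<close> lies below the
  old stem, nothing has been cut off.\<close>

lemma tree_below_laver:
  assumes T: "T \<in> laver_trees" and t: "t \<in> T"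
  shows "tree_below t T \<in> laver_trees"
proof -
  from T obtain s where s: "s \<in> T" "\<And>u. u \<in> T \<Longrightarrow> prefix u s \<or> prefix s u"
    "\<And>u. u \<in> T \<Longrightarrow> prefix s u \<Longrightarrow> infinite (successors UNIV u T)"
    by (auto simp: laver_trees_def)
  show ?thesis
  proof (cases "prefix s t")
    case True
    have "is_tree UNIV (tree_below t T)"
      using T t by (auto simp: laver_trees_def intro: is_tree_tree_below)
    moreover have "t \<in> tree_below t T" using t by (simp add: tree_below_def)
    moreover have "infinite (successors UNIV u (tree_below t T))"
      if "u \<in> tree_below t T" "prefix t u" for u
      using s(3)[of u] that True
      by (auto simp: successors_tree_below in_tree_below intro: prefix_order.trans)
    ultimately show ?thesis
      unfolding laver_trees_def by (auto simp: tree_below_def)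
  next
    case False
    then have ts: "prefix t s" using s t by blast
    have "prefix u t \<or> prefix t u" if "u \<in> T" for u
      using s(2)[OF that] ts prefix_same_cases[of u s t] prefix_order.trans[of t s u] by blast
    then have "tree_below t T = T" by (auto simp: tree_below_def)
    then show ?thesis using T by simp
  qed
qed

lemma mono_paths: "mono (paths K)"
  by (auto simp: mono_def paths_def)

lemma trees_lepoll_continuum: "(P :: nat list set set) \<lesssim> (UNIV :: nat set set)"
proof -
  have "inj (\<lambda>T. (to_nat :: nat list \<Rightarrow> nat) ` T)"
    by (simp add: inj_image_eq_iff inj_def)
  then show ?thesis
    unfolding lepoll_def by (blast intro: inj_on_subset)
qed

lemma tree_node_of_length:
  assumes T: "is_tree K T"
  shows "\<exists>t\<in>T. length t = n"
proof (induction n)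
  case 0
  have "[] \<in> T" using T by (auto simp: is_tree_def)
  then show ?case by auto
next
  case (Suc n)
  then obtain t where t: "t \<in> T" "length t = n" by blast
  with T obtain k where "t @ [k] \<in> T" by (fastforce simp: is_tree_def successors_def)
  with t show ?case by (intro bexI[of _ "t @ [k]"]) auto
qed

text \<open>Shrink the tree in countably many steps, restricting it to a node of length \<open>n\<close> in step \<open>n\<close>.
  The chosen nodes are then linearly ordered, and the branch through them is a path of every
  tree of the sequence. Fixing nodes this way replaces compactness, which Laver trees do not have.\<close>

lemma point_catching_trees:
  assumes tree: "\<And>T. T \<in> \<T> \<Longrightarrow> is_tree K T"
    and below: "\<And>T t. T \<in> \<T> \<Longrightarrow> t \<in> T \<Longrightarrow> tree_below t T \<in> \<T>"
  shows "point_catching \<T> (paths K)"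
  unfolding point_catching_def
proof (intro ballI allI impI)
  fix d and U :: "nat \<Rightarrow> (nat \<Rightarrow> nat) set"
  assume d: "d \<in> \<T>"
    and U: "\<forall>i. \<forall>p\<in>\<T>. p \<subseteq> d \<longrightarrow> (\<exists>q\<in>\<T>. q \<subseteq> p \<and> paths K q \<subseteq> U i)"
  have "\<exists>T. \<forall>n. (T n \<in> \<T> \<and> T n \<subseteq> d) \<and>
      (T (Suc n) \<subseteq> T n \<and> paths K (T (Suc n)) \<subseteq> U n \<and>
        (\<exists>t\<in>T n. length t = n \<and> T (Suc n) \<subseteq> tree_below t (T n)))"
  proof (rule dependent_nat_choice)
    show "\<exists>T. T \<in> \<T> \<and> T \<subseteq> d" using d by blast
    fix T n assume T: "T \<in> \<T> \<and> T \<subseteq> d"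
    obtain t where t: "t \<in> T" "length t = n" using tree_node_of_length tree T by blast
    have "tree_below t T \<in> \<T>" "tree_below t T \<subseteq> T"
      using below T t by (auto simp: tree_below_def)
    then obtain Q where "Q \<in> \<T>" "Q \<subseteq> tree_below t T" "paths K Q \<subseteq> U n"
      using U T by (meson subset_trans)
    then show "\<exists>Q. (Q \<in> \<T> \<and> Q \<subseteq> d) \<and>
        (Q \<subseteq> T \<and> paths K Q \<subseteq> U n \<and> (\<exists>t\<in>T. length t = n \<and> Q \<subseteq> tree_below t T))"
      using T t \<open>tree_below t T \<subseteq> T\<close> by (intro exI[of _ Q]) blast
  qed
  then obtain T where T: "\<And>n. T n \<in> \<T>" "\<And>n. T (Suc n) \<subseteq> T n" "\<And>n. paths K (T (Suc n)) \<subseteq> U n"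
    and "\<forall>n. \<exists>t\<in>T n. length t = n \<and> T (Suc n) \<subseteq> tree_below t (T n)" by blast
  then obtain t where t: "\<And>n. t n \<in> T n" "\<And>n. length (t n) = n"
    "\<And>n. T (Suc n) \<subseteq> tree_below (t n) (T n)" by metis
  have anti: "T n \<subseteq> T m" if "m \<le> n" for m n
    using lift_Suc_antimono_le[of T m n] T(2) that by blast
  have pre: "prefix (t m) (t n)" if "m \<le> n" for m n
  proof (cases "m = n")
    case False
    then have "t n \<in> tree_below (t m) (T m)"
      using t(1)[of n] t(3)[of m] anti[of "Suc m" n] that by auto
    then show ?thesis
      using t(2) that False by (auto simp: tree_below_def dest: prefix_length_le)
  qed simp
  have tT: "t n \<in> T m" for m n
  proof (cases "m \<le> n")
    case False
    then have "prefix (t n) (t m)" using pre by simp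
    then show ?thesis using t(1)[of m] tree[OF T(1)[of m]] unfolding is_tree_def by blast
  qed (use anti t(1) in blast)
  \<comment> \<open>the node \<open>t (Suc n)\<close> is the first one that has an entry at position \<open>n\<close>\<close>
  define x where "x n = t (Suc n) ! n" for n
  have x: "map x [0..<n] = t n" for n
  proof (rule nth_equalityI)
    fix i assume "i < length (map x [0..<n])"
    then have "i < n" by simp
    moreover from this have "prefix (t (Suc i)) (t n)" by (intro pre) simp
    ultimately show "map x [0..<n] ! i = t n ! i"
      using t(2)[of "Suc i"] by (auto simp: x_def prefix_def nth_append)
  qed (simp add: t(2))
  have "x n \<in> K" for n
  proof -
    have "t (Suc n) \<in> lists K"
      using t(1)[of "Suc n"] tree[OF T(1)[of "Suc n"]] unfolding is_tree_def by blast
    then show ?thesis using t(2)[of "Suc n"] by (auto simp: x_def in_lists_conv_set)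
  qed
  then have "x \<in> paths K (T m)" for m
    using x tT by (auto simp: paths_def)
  then have "x \<in> (\<Inter>i. U i)" using T(3) by blast
  then show "(\<Inter>i. U i) \<noteq> {}" by blast
qed

lemma point_catching_sacks: "point_catching sacks_trees (paths {0, 1})"
proof (rule point_catching_trees)
  show "is_tree {0, 1} T" if "T \<in> sacks_trees" for T
    using that unfolding sacks_trees_def by blast
qed (rule tree_below_sacks)

lemma point_catching_laver: "point_catching laver_trees (paths UNIV)"
proof (rule point_catching_trees)
  show "is_tree UNIV T" if "T \<in> laver_trees" for T
    using that unfolding laver_trees_def by blast
qed (rule tree_below_laver)

section \<open>EL-sets\<close>

text \<open>Finite parts can only grow when EL-sets shrink: an element of \<open>b\<close> outside \<open>a\<close> could be
  omitted from a member of the smaller EL-set.\<close>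

lemma ellentuck_subset_iff:
  assumes inf: "infinite A" and fin: "finite a" "finite b"
  shows "ellentuck a A \<subseteq> ellentuck b B \<longleftrightarrow> b \<subseteq> a \<and> a \<union> A \<subseteq> b \<union> B"
proof
  assume sub: "ellentuck a A \<subseteq> ellentuck b B"
  have *: "a \<union> C \<in> ellentuck b B" if "C \<subseteq> A" "infinite C" for C
  proof -
    have "a \<union> C \<noteq> a" using that fin by (metis finite_Un)
    then show ?thesis
      using sub that by (auto simp: ellentuck_def inf_subsets_def)
  qed
  have "b \<subseteq> a \<union> (A - b)"
    using *[of "A - b"] inf fin by (auto simp: ellentuck_def)
  moreover have "a \<union> A \<subseteq> b \<union> B"
    using *[of A] inf by (auto simp: ellentuck_def)
  ultimately show "b \<subseteq> a \<and> a \<union> A \<subseteq> b \<union> B" by blast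
next
  assume "b \<subseteq> a \<and> a \<union> A \<subseteq> b \<union> B"
  then show "ellentuck a A \<subseteq> ellentuck b B"
    by (auto simp: ellentuck_def)
qed

lemma ellentuck_mono: "A \<subseteq> B \<Longrightarrow> ellentuck a A \<subseteq> ellentuck a B"
  by (auto simp: ellentuck_def)

lemma EL_sets_lepoll_continuum: "EL_sets \<lesssim> (UNIV :: nat set set)"
proof -
  have "EL_sets \<lesssim> {a :: nat set. finite a} \<times> {A :: nat set. infinite A}"
    by (rule subset_image_lepoll[where f = "\<lambda>(a, A). ellentuck a A"]) (auto simp: EL_sets_def)
  also have "\<dots> \<lesssim> (UNIV :: nat set set) \<times> (UNIV :: nat set)"
  proof (rule lepoll_trans)
    have "{a :: nat set. finite a} \<lesssim> (UNIV :: nat set)"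
      using countable_Collect_finite by (auto simp: countable_def lepoll_def)
    then show "{a :: nat set. finite a} \<times> {A :: nat set. infinite A} \<lesssim> (UNIV :: nat set) \<times> (UNIV :: nat set set)"
      by (intro times_lepoll_mono subset_imp_lepoll) auto
    show "(UNIV :: nat set) \<times> (UNIV :: nat set set) \<lesssim> (UNIV :: nat set set) \<times> (UNIV :: nat set)"
      by (rule eqpoll_imp_lepoll[OF times_commute_eqpoll])
  qed
  also have "\<dots> \<lesssim> (UNIV :: nat set set)"
    by (rule times_nat_lepoll_continuum) simp
  finally show ?thesis .
qed

text \<open>As for trees, with the finite parts in the role of the nodes: in each step the finite part
  is enlarged before the next set is considered, and the union of all finite parts is the common
  point.\<close>

lemma point_catching_EL: "point_catching EL_sets (\<lambda>E. E)"
  unfolding point_catching_def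
proof (intro ballI allI impI)
  fix d and U :: "nat \<Rightarrow> nat set set"
  assume d: "d \<in> EL_sets"
    and U: "\<forall>i. \<forall>p\<in>EL_sets. p \<subseteq> d \<longrightarrow> (\<exists>q\<in>EL_sets. q \<subseteq> p \<and> q \<subseteq> U i)"
  define cell where "cell c = ellentuck (fst c) (snd c)" for c
  define ok where "ok c \<longleftrightarrow> finite (fst c) \<and> infinite (snd c) \<and> cell c \<subseteq> d" for c
  have "\<exists>c. \<forall>n. ok (c n) \<and> (fst (c n) \<subset> fst (c (Suc n)) \<and> cell (c (Suc n)) \<subseteq> cell (c n) \<inter> U n)"
  proof (rule dependent_nat_choice)
    show "\<exists>c. ok c"
      using d by (auto simp: EL_sets_def ok_def cell_def)
    fix c n assume "ok c"
    then have c: "finite (fst c)" "infinite (snd c)" "ellentuck (fst c) (snd c) \<subseteq> d"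
      by (simp_all add: ok_def cell_def)
    obtain a A where aA: "c = (a, A)" by fastforce
    from c aA have "infinite (A - a)" by simp
    then obtain k where k: "k \<in> A" "k \<notin> a"
      by (metis DiffE finite.emptyI ex_in_conv)
    \<comment> \<open>this step makes the finite parts grow, so that their union is infinite\<close>
    have sub: "ellentuck (insert k a) A \<subseteq> ellentuck a A"
      using k c aA by (subst ellentuck_subset_iff) auto
    have "ellentuck (insert k a) A \<in> EL_sets" "ellentuck (insert k a) A \<subseteq> d"
      using c aA sub by (auto simp: EL_sets_def)
    then obtain q where "q \<in> EL_sets" "q \<subseteq> ellentuck (insert k a) A" "q \<subseteq> U n"
      using U by blast
    then obtain b B where q: "finite b" "infinite B" "ellentuck b B \<subseteq> ellentuck (insert k a) A"
      "ellentuck b B \<subseteq> U n" by (auto simp: EL_sets_def)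
    then have "insert k a \<subseteq> b"
      using ellentuck_subset_iff[of B b "insert k a" A] c aA by simp
    moreover have "ellentuck b B \<subseteq> ellentuck a A" "ellentuck b B \<subseteq> d"
      using q sub c aA by auto
    ultimately show "\<exists>c'. ok c' \<and> (fst c \<subset> fst c' \<and> cell c' \<subseteq> cell c \<inter> U n)"
      using q k aA by (intro exI[of _ "(b, B)"]) (auto simp: ok_def cell_def)
  qed
  then obtain c where c: "\<And>n. ok (c n)" "\<And>n. fst (c n) \<subset> fst (c (Suc n))"
    "\<And>n. cell (c (Suc n)) \<subseteq> cell (c n) \<inter> U n" by metis
  have fin: "finite (fst (c n))" and inf: "infinite (snd (c n))" for n
    using c(1) by (simp_all add: ok_def)
  define X where "X = (\<Union>n. fst (c n))"
  have "cell (c n) \<subseteq> cell (c m)" if "m \<le> n" for m n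
    using lift_Suc_antimono_le[of "\<lambda>n. cell (c n)" m n] c(3) that by blast
  then have incl: "fst (c m) \<subseteq> fst (c n) \<and> fst (c n) \<union> snd (c n) \<subseteq> fst (c m) \<union> snd (c m)"
    if "m \<le> n" for m n
    using ellentuck_subset_iff[OF inf fin fin] that unfolding cell_def by blast
  have strict: "fst (c m) \<subset> X" for m
    using c(2)[of m] unfolding X_def by blast
  have "infinite X"
  proof
    assume "finite X"
    moreover have "range (\<lambda>n. fst (c n)) \<subseteq> Pow X" by (auto simp: X_def)
    ultimately have "finite (range (\<lambda>n. fst (c n)))" by (meson finite_Pow_iff finite_subset)
    moreover have "strict_mono (\<lambda>n. fst (c n))"
      using c(2) by (simp add: strict_mono_Suc_iff)
    then have "inj (\<lambda>n. fst (c n))" by (rule strict_mono_imp_inj_on)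
    ultimately show False by (simp add: finite_image_iff)
  qed
  moreover have "X \<subseteq> fst (c m) \<union> snd (c m)" for m
  proof -
    have "fst (c n) \<subseteq> fst (c m) \<union> snd (c m)" for n
      using incl[of m n] incl[of n m] by (cases "m \<le> n") auto
    then show ?thesis unfolding X_def by blast
  qed
  ultimately have "X \<in> cell (c m)" for m
    using strict by (auto simp: cell_def ellentuck_def inf_subsets_def)
  then have "X \<in> (\<Inter>i. U i)" using c(3) by blast
  then show "(\<Inter>i. U i) \<noteq> {}" by blast
qed

section \<open>Nowhere dense sets are Ramsey null\<close>

text \<open>Fusion along a sequence of reservoirs: \<open>B\<close> consists of the least elements of a decreasing
  sequence of infinite sets, where each set satisfies \<open>R s\<close> for the finitely many sets \<open>s\<close>
  bounded by the least element of its predecessor. Only the part of \<open>B\<close> above \<open>s\<close> is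
  contained in that reservoir, which is why the conclusion speaks of this part.\<close>

lemma diagonal_intersection:
  fixes R :: "nat set \<Rightarrow> nat set \<Rightarrow> bool"
  assumes hered: "\<And>s B C. R s B \<Longrightarrow> C \<subseteq> B \<Longrightarrow> R s C"
    and dense: "\<And>s A. finite s \<Longrightarrow> infinite A \<Longrightarrow> \<exists>B\<subseteq>A. infinite B \<and> R s B"
    and A: "infinite A"
  shows "\<exists>B\<subseteq>A. infinite B \<and> (\<forall>s. finite s \<longrightarrow> s \<subseteq> B \<longrightarrow> R s {n\<in>B. \<forall>m\<in>s. m < n})"
proof -
  have finitely_many: "\<exists>B\<subseteq>A. infinite B \<and> (\<forall>s\<in>\<S>. R s B)"
    if "finite \<S>" "\<forall>s\<in>\<S>. finite s" "infinite A" for \<S> A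
    using that
  proof (induction \<S> rule: finite_induct)
    case (insert s \<S>)
    then obtain B where B: "B \<subseteq> A" "infinite B" "\<forall>s\<in>\<S>. R s B" by auto
    obtain C where C: "C \<subseteq> B" "infinite C" "R s C"
      using dense[of s B] insert.prems(1) B(2) by auto
    then have "\<forall>s\<in>\<S>. R s C" using B(3) hered by meson
    with B(1) C show ?case by (intro exI[of _ C]) simp
  qed blast
  obtain A0 where A0: "A0 \<subseteq> A" "infinite A0" "R {} A0" using dense A by blast
  define nxt where "nxt B = (LEAST n. n \<in> B)" for B :: "nat set"
  have nxt: "nxt B \<in> B" if "infinite B" for B
    using that unfolding nxt_def by (metis LeastI finite.emptyI ex_in_conv)
  have "\<exists>b. \<forall>k. (b k \<subseteq> A0 \<and> infinite (b k)) \<and>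
      (b (Suc k) \<subseteq> b k \<inter> {nxt (b k)<..} \<and> (\<forall>s\<in>Pow {..nxt (b k)}. R s (b (Suc k))))"
  proof (rule dependent_nat_choice)
    show "\<exists>B. B \<subseteq> A0 \<and> infinite B" using A0 by blast
    fix B and k :: nat assume B: "B \<subseteq> A0 \<and> infinite B"
    have "infinite (B \<inter> {nxt B<..})"
    proof
      assume "finite (B \<inter> {nxt B<..})"
      then have "finite (B \<inter> {nxt B<..} \<union> {..nxt B})" by simp
      moreover have "B \<subseteq> B \<inter> {nxt B<..} \<union> {..nxt B}" by auto
      ultimately show False using B finite_subset by blast
    qed
    moreover have "\<forall>s\<in>Pow {..nxt B}. finite s" by (auto intro: finite_subset)
    ultimately obtain C where "C \<subseteq> B \<inter> {nxt B<..}" "infinite C" "\<forall>s\<in>Pow {..nxt B}. R s C"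
      using finitely_many[of "Pow {..nxt B}" "B \<inter> {nxt B<..}"] by auto
    then show "\<exists>C. (C \<subseteq> A0 \<and> infinite C) \<and>
        (C \<subseteq> B \<inter> {nxt B<..} \<and> (\<forall>s\<in>Pow {..nxt B}. R s C))"
      using B by blast
  qed
  then obtain b where b: "\<And>k. b k \<subseteq> A0" "\<And>k. infinite (b k)"
    "\<And>k. b (Suc k) \<subseteq> b k \<inter> {nxt (b k)<..}"
    "\<And>k. \<forall>s\<in>Pow {..nxt (b k)}. R s (b (Suc k))"
    by metis
  define n where "n k = nxt (b k)" for k
  have n_in: "n k \<in> b k" for k using nxt b(2) by (simp add: n_def)
  have anti: "b k \<subseteq> b j" if "j \<le> k" for j k
    using lift_Suc_antimono_le[of b j k] b(3) that by blast
  have "n k < n (Suc k)" for k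
    using n_in[of "Suc k"] b(3)[of k] by (auto simp: n_def)
  then have sm: "strict_mono n" by (simp add: strict_mono_Suc_iff)
  show ?thesis
  proof (intro exI[of _ "range n"] conjI allI impI)
    show "range n \<subseteq> A" using n_in b(1) A0(1) by blast
    show "infinite (range n)" using sm by (simp add: range_inj_infinite strict_mono_imp_inj_on)
    fix s assume s: "finite s" "s \<subseteq> range n"
    show "R s {i \<in> range n. \<forall>m\<in>s. m < i}"
    proof (cases "s = {}")
      case True
      have "range n \<subseteq> A0" using n_in b(1) by blast
      with True show ?thesis using hered[OF A0(3)] by simp
    next
      case False
      then obtain k where k: "Max s = n k" using s Max_in by blast
      have "s \<subseteq> {..nxt (b k)}" using s k Max_ge by (fastforce simp: n_def)
      moreover have "{i \<in> range n. \<forall>m\<in>s. m < i} \<subseteq> b (Suc k)"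
      proof clarify
        fix j assume "\<forall>m\<in>s. m < n j"
        then have "n k < n j" using Max_in[OF s(1) False] k by simp
        then have "k < j" using sm by (simp add: strict_mono_less)
        then show "n j \<in> b (Suc k)" using anti[of "Suc k" j] n_in[of j] by auto
      qed
      ultimately show ?thesis using b(4)[of k] hered by blast
    qed
  qed
qed

text \<open>Rejection in the sense of Galvin and Prikry, where a reservoir accepts \<open>b\<close> if its EL-set
  with finite part \<open>b\<close> avoids \<open>M\<close>.\<close>

definition rejects :: "nat set set \<Rightarrow> nat set \<Rightarrow> nat set \<Rightarrow> bool" where
  "rejects M b A \<longleftrightarrow> (\<forall>B\<subseteq>A. infinite B \<longrightarrow> ellentuck b B \<inter> M \<noteq> {})"

lemma infinite_Collect_above:
  assumes "infinite B" "finite s"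
  shows "infinite {n\<in>B. \<forall>m\<in>s. m < (n::nat)}"
proof
  assume "finite {n\<in>B. \<forall>m\<in>s. m < n}"
  moreover have "B \<subseteq> {n\<in>B. \<forall>m\<in>s. m < n} \<union> (\<Union>m\<in>s. {..m})"
    by (auto simp: not_less)
  ultimately show False
    using assms by (meson finite_UN_I finite_UnI finite_atMost finite_subset)
qed

text \<open>A reservoir that accepts \<open>b\<close> still does so when finitely many elements are removed.\<close>

lemma rejects_above:
  assumes "finite s" "rejects M b {n\<in>A. \<forall>m\<in>s. m < n}"
  shows "rejects M b A"
  unfolding rejects_def
proof (intro allI impI)
  fix B assume B: "B \<subseteq> A" "infinite B"
  let ?C = "{n\<in>B. \<forall>m\<in>s. m < n}"
  have "?C \<subseteq> {n\<in>A. \<forall>m\<in>s. m < n}" using B(1) by blast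
  then have "ellentuck b ?C \<inter> M \<noteq> {}"
    using assms(2) infinite_Collect_above[OF B(2) assms(1)] by (simp add: rejects_def)
  moreover have "ellentuck b ?C \<subseteq> ellentuck b B"
    by (rule ellentuck_mono) blast
  ultimately show "ellentuck b B \<inter> M \<noteq> {}" by blast
qed

text \<open>Contrapositively, a set that is nowhere dense in the Ellentuck topology is Ramsey null. Suppose
  that \<open>a\<close> is rejected by \<open>A\<close>. A first fusion makes the reservoir decide, for each of its finite
  subsets \<open>s\<close>, whether \<open>a \<union> s\<close> is rejected. If \<open>a \<union> s\<close> is rejected, then so are almost all of
  its one-point extensions, since infinitely many accepted ones would together yield an
  accepting reservoir for \<open>a \<union> s\<close>. A second fusion removes the exceptions, and then every
  \<open>a \<union> s\<close> is rejected by induction on \<open>s\<close>. This says that every EL-set inside that of \<open>a\<close> and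
  the final reservoir \<open>C\<close> meets \<open>M\<close>.\<close>

lemma dense_in_some_EL_set:
  assumes M: "M \<subseteq> inf_subsets UNIV" "M \<notin> NR_sets"
  shows "\<exists>E\<in>EL_sets. \<forall>D\<in>EL_sets. D \<subseteq> E \<longrightarrow> M \<inter> D \<noteq> {}"
proof -
  from M have "\<exists>a A. finite a \<and> infinite A \<and> (\<forall>B\<in>inf_subsets A. ellentuck a B \<inter> M \<noteq> {})"
    unfolding NR_sets_def by simp
  then obtain a A where a: "finite a" and A: "infinite A" and rej: "rejects M a A"
    unfolding rejects_def inf_subsets_def mem_Collect_eq Ball_def by metis
  define decided where
    "decided s B \<longleftrightarrow> ellentuck (a \<union> s) B \<inter> M = {} \<or> rejects M (a \<union> s) B" for s B
  have "\<exists>B\<subseteq>A. infinite B \<and> (\<forall>s. finite s \<longrightarrow> s \<subseteq> B \<longrightarrow> decided s {n\<in>B. \<forall>m\<in>s. m < n})"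
  proof (rule diagonal_intersection[OF _ _ A])
    show "decided s C" if "decided s B" "C \<subseteq> B" for s B C
      using that(1) unfolding decided_def
    proof
      assume "ellentuck (a \<union> s) B \<inter> M = {}"
      then show "ellentuck (a \<union> s) C \<inter> M = {} \<or> rejects M (a \<union> s) C"
        using ellentuck_mono[OF that(2), of "a \<union> s"] by blast
    next
      assume "rejects M (a \<union> s) B"
      then show "ellentuck (a \<union> s) C \<inter> M = {} \<or> rejects M (a \<union> s) C"
        using that(2) unfolding rejects_def by (meson subset_trans)
    qed
    show "\<exists>B\<subseteq>A. infinite B \<and> decided s B" if "infinite A" for s A
    proof (cases "rejects M (a \<union> s) A")
      case False
      then obtain B where "B \<subseteq> A" "infinite B" "ellentuck (a \<union> s) B \<inter> M = {}"
        unfolding rejects_def by meson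
      then show ?thesis unfolding decided_def by blast
    qed (use that in \<open>auto simp: decided_def\<close>)
  qed
  then obtain B where B: "B \<subseteq> A" "infinite B"
    and B_decides: "\<forall>s. finite s \<longrightarrow> s \<subseteq> B \<longrightarrow> decided s {n\<in>B. \<forall>m\<in>s. m < n}"
    by meson
  have dec: "ellentuck (a \<union> s) {n\<in>B. \<forall>m\<in>s. m < n} \<inter> M = {} \<or> rejects M (a \<union> s) B"
    if "finite s" "s \<subseteq> B" for s
    using B_decides that rejects_above[OF that(1)] unfolding decided_def by meson
  have finite_defect: "finite {n\<in>B. (\<forall>m\<in>s. m < n) \<and> \<not> rejects M (a \<union> insert n s) B}" (is "finite ?N")
    if s: "finite s" "s \<subseteq> B" "rejects M (a \<union> s) B" for s
  proof (rule ccontr)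
    assume inf: "infinite ?N"
    moreover have "?N \<subseteq> B" by blast
    ultimately have "ellentuck (a \<union> s) ?N \<inter> M \<noteq> {}"
      using s(3) unfolding rejects_def by meson
    then obtain X where "X \<in> M" "X \<in> ellentuck (a \<union> s) ?N" by blast
    then have X: "X \<in> M" "infinite X" "a \<union> s \<subset> X" "X \<subseteq> a \<union> s \<union> ?N"
      unfolding ellentuck_def inf_subsets_def by simp_all
    define n where "n = (LEAST n. n \<in> X - (a \<union> s))"
    have n: "n \<in> X - (a \<union> s)"
      unfolding n_def by (rule LeastI_ex) (use X(3) in blast)
    have least: "n \<le> k" if "k \<in> X - (a \<union> s)" for k
      unfolding n_def by (rule Least_le) (rule that)
    have nN: "n \<in> ?N" using n X(4) by (meson DiffD1 DiffD2 UnE subsetD)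
    \<comment> \<open>\<open>a \<union> insert n s\<close> is not rejected, so \<open>B\<close> has accepted it\<close>
    have "ellentuck (a \<union> insert n s) {k\<in>B. \<forall>m\<in>insert n s. m < k} \<inter> M = {}"
      using dec[of "insert n s"] s nN by auto
    moreover have "X \<in> ellentuck (a \<union> insert n s) {k\<in>B. \<forall>m\<in>insert n s. m < k}"
    proof -
      have "X \<noteq> a \<union> insert n s" using X(2) a s(1) by auto
      moreover have "k \<in> a \<union> insert n s \<union> {k\<in>B. \<forall>m\<in>insert n s. m < k}" if k: "k \<in> X" for k
      proof (cases "k \<in> a \<union> insert n s")
        case False
        then have "k \<in> ?N" using X(4) k by blast
        moreover have "n < k" using least[of k] k False by (simp add: le_neq_implies_less)
        ultimately show ?thesis by simp
      qed blast
      moreover have "a \<union> insert n s \<subseteq> X" using X(3) n by blast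
      ultimately show ?thesis
        using X(2) unfolding ellentuck_def inf_subsets_def mem_Collect_eq by blast
    qed
    ultimately show False using X(1) by blast
  qed
  \<comment> \<open>the relation ignores the part of \<open>C\<close> outside \<open>B\<close>, so that it is dense for all reservoirs\<close>
  define R where "R s C \<longleftrightarrow> (s \<subseteq> B \<longrightarrow> rejects M (a \<union> s) B \<longrightarrow>
    (\<forall>n\<in>B \<inter> C. (\<forall>m\<in>s. m < n) \<longrightarrow> rejects M (a \<union> insert n s) B))" for s C
  have "\<exists>C\<subseteq>B. infinite C \<and> (\<forall>s. finite s \<longrightarrow> s \<subseteq> C \<longrightarrow> R s {n\<in>C. \<forall>m\<in>s. m < n})"
  proof (rule diagonal_intersection[OF _ _ B(2)])
    show "R s C" if "R s B" "C \<subseteq> B" for s B C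
      using that unfolding R_def by blast
    fix s A' :: "nat set" assume s: "finite s" and A': "infinite A'"
    show "\<exists>C\<subseteq>A'. infinite C \<and> R s C"
    proof (cases "s \<subseteq> B \<and> rejects M (a \<union> s) B")
      case True
      let ?N = "{n\<in>B. (\<forall>m\<in>s. m < n) \<and> \<not> rejects M (a \<union> insert n s) B}"
      have "infinite (A' - ?N)" using finite_defect True s A' by simp
      moreover have "R s (A' - ?N)" by (auto simp: R_def)
      ultimately show ?thesis by blast
    qed (use A' in \<open>auto simp: R_def\<close>)
  qed
  then obtain C where C: "C \<subseteq> B" "infinite C"
    and RC: "\<And>s. finite s \<Longrightarrow> s \<subseteq> C \<Longrightarrow> R s {n\<in>C. \<forall>m\<in>s. m < n}" by blast
  have all_rejected: "s \<subseteq> C \<Longrightarrow> rejects M (a \<union> s) B" if "finite s" for s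
    using that
  proof (induction s rule: finite_linorder_max_induct)
    case empty
    show ?case using rej B(1) by (auto simp: rejects_def)
  next
    case (insert n s)
    with RC[of s] C(1) show ?case by (auto simp: R_def)
  qed
  show ?thesis
  proof (intro bexI ballI impI)
    show "ellentuck a C \<in> EL_sets" using a C(2) by (auto simp: EL_sets_def)
    fix D assume D: "D \<in> EL_sets" "D \<subseteq> ellentuck a C"
    then obtain b D' where D': "D = ellentuck b D'" "finite b" "infinite D'"
      by (auto simp: EL_sets_def)
    then have ab: "a \<subseteq> b" "b \<union> D' \<subseteq> a \<union> C"
      using D(2) ellentuck_subset_iff[of D' b a C] a by auto
    then have "rejects M b B"
      using all_rejected[of "b - a"] D'(2) by (simp add: Un_absorb1 Diff_subset_conv)
    moreover have "infinite (D' \<inter> C)"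
    proof -
      have "D' - a \<subseteq> D' \<inter> C" using ab by blast
      then show ?thesis using D'(3) a by (metis finite_Diff2 infinite_super)
    qed
    ultimately have "ellentuck b (D' \<inter> C) \<inter> M \<noteq> {}"
      using C(1) unfolding rejects_def by blast
    then show "M \<inter> D \<noteq> {}"
      using ellentuck_mono[of "D' \<inter> C" D' b] D'(1) by blast
  qed
qed

section \<open>Subfamilies with non-measurable union\<close>

lemma dense_in_some_tree:
  assumes "A \<subseteq> (UNIV \<rightarrow> K)" "A \<notin> t0_sets \<T> K"
  shows "\<exists>T\<in>\<T>. \<forall>Q\<in>\<T>. Q \<subseteq> T \<longrightarrow> A \<inter> paths K Q \<noteq> {}"
  using assms by (simp add: t0_sets_def Int_commute)

lemma non_t_set_subfamily:
  assumes catch: "point_catching \<T> (paths K)"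
    and A: "A \<subseteq> (UNIV \<rightarrow> K)" "A \<notin> t0_sets \<T> K"
    and cover: "point_finite_cover \<F> A"
    and rich: "\<forall>T\<in>\<T>. A \<inter> paths K T \<noteq> {} \<longrightarrow>
      (\<exists>Q\<in>\<T>. Q \<subseteq> T \<and> A \<inter> paths K Q \<noteq> {} \<and> card_continuum (restrict_family \<F> (paths K Q)))"
  shows "\<exists>Q\<in>\<T>. A \<inter> paths K Q \<noteq> {} \<and> card_continuum (restrict_family \<F> (paths K Q)) \<and>
    (\<exists>\<F>'\<subseteq>\<F>. \<Union>(restrict_family \<F>' (paths K Q)) \<notin> t_sets \<T> K)"
proof -
  obtain T where T: "T \<in> \<T>" "\<forall>Q\<in>\<T>. Q \<subseteq> T \<longrightarrow> A \<inter> paths K Q \<noteq> {}"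
    using dense_in_some_tree[OF A] by blast
  obtain Q \<F>' S where Q: "Q \<in> \<T>" "A \<inter> paths K Q \<noteq> {}"
      "card_continuum (restrict_family \<F> (paths K Q))" "\<F>' \<subseteq> \<F>" and S: "S \<in> \<T>"
    and undecided: "\<forall>R\<in>\<T>. R \<subseteq> S \<longrightarrow>
       \<not> paths K R \<subseteq> \<Union>(restrict_family \<F>' (paths K Q)) \<and>
       paths K R \<inter> \<Union>(restrict_family \<F>' (paths K Q)) \<noteq> {}"
    using undecided_subfamily_union[OF mono_paths trees_lepoll_continuum catch cover T rich]
    by blast
  have "\<Union>(restrict_family \<F>' (paths K Q)) \<notin> t_sets \<T> K"
    using S undecided unfolding t_sets_def by blast
  with Q show ?thesis by blast
qed

lemma non_CR_set_subfamily:
  assumes M: "M \<subseteq> inf_subsets UNIV" "M \<notin> NR_sets"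
    and cover: "point_finite_cover \<F> M"
    and rich: "\<forall>E\<in>EL_sets. M \<inter> E \<noteq> {} \<longrightarrow>
      (\<exists>D\<in>EL_sets. D \<subseteq> E \<and> M \<inter> D \<noteq> {} \<and> card_continuum (restrict_family \<F> D))"
  shows "\<exists>D\<in>EL_sets. M \<inter> D \<noteq> {} \<and> card_continuum (restrict_family \<F> D) \<and>
    (\<exists>\<F>'\<subseteq>\<F>. \<Union>(restrict_family \<F>' D) \<notin> CR_sets)"
proof -
  obtain E where E: "E \<in> EL_sets" "\<forall>D\<in>EL_sets. D \<subseteq> E \<longrightarrow> M \<inter> D \<noteq> {}"
    using dense_in_some_EL_set[OF M] by (rule bexE)
  have mono_id: "mono (\<lambda>E :: nat set set. E)" by (simp add: mono_def)
  obtain D \<F>' C where D: "D \<in> EL_sets" "M \<inter> D \<noteq> {}"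
      "card_continuum (restrict_family \<F> D)" "\<F>' \<subseteq> \<F>" and C: "C \<in> EL_sets"
    and undecided: "\<forall>B\<in>EL_sets. B \<subseteq> C \<longrightarrow>
       \<not> B \<subseteq> \<Union>(restrict_family \<F>' D) \<and> B \<inter> \<Union>(restrict_family \<F>' D) \<noteq> {}"
    using undecided_subfamily_union[OF mono_id EL_sets_lepoll_continuum
        point_catching_EL cover E rich]
    by (elim bexE conjE exE) (rule that)
  have "\<Union>(restrict_family \<F>' D) \<notin> CR_sets"
  proof
    assume CR: "\<Union>(restrict_family \<F>' D) \<in> CR_sets"
    obtain a A where aA: "C = ellentuck a A" "finite a" "infinite A"
      using C by (auto simp: EL_sets_def)
    with CR obtain B where "B \<in> inf_subsets A"
      "ellentuck a B \<subseteq> \<Union>(restrict_family \<F>' D) \<or> ellentuck a B \<inter> \<Union>(restrict_family \<F>' D) = {}"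
      unfolding CR_sets_def mem_Collect_eq by meson
    moreover from this have "ellentuck a B \<in> EL_sets" "ellentuck a B \<subseteq> C"
      using aA ellentuck_mono by (auto simp: EL_sets_def inf_subsets_def)
    ultimately show False using undecided by blast
  qed
  with D show ?thesis by blast
qed

theorem theorem1:
  shows "(\<forall>\<T> K A \<F>.
            (\<T>, K) \<in> {(sacks_trees, {0, 1}), (laver_trees, UNIV)} \<and>
            A \<subseteq> (UNIV \<rightarrow> K) \<and> A \<notin> t0_sets \<T> K \<and>
            point_finite_cover \<F> A \<and> \<F> \<subseteq> t0_sets \<T> K \<and>
            (\<forall>T\<in>\<T>. A \<inter> paths K T \<noteq> {} \<longrightarrow>
               (\<exists>Q\<in>\<T>. Q \<subseteq> T \<and> A \<inter> paths K Q \<noteq> {} \<and>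
                  card_continuum (restrict_family \<F> (paths K Q)))) \<longrightarrow>
            (\<exists>Q\<in>\<T>. A \<inter> paths K Q \<noteq> {} \<and> card_continuum (restrict_family \<F> (paths K Q)) \<and>
               (\<exists>\<F>'\<subseteq>\<F>. \<Union>(restrict_family \<F>' (paths K Q)) \<notin> t_sets \<T> K)))
       \<and>
         (\<forall>M \<F>.
            M \<subseteq> inf_subsets UNIV \<and> M \<notin> NR_sets \<and>
            point_finite_cover \<F> M \<and> \<F> \<subseteq> NR_sets \<and>
            (\<forall>E\<in>EL_sets. M \<inter> E \<noteq> {} \<longrightarrow>
               (\<exists>D\<in>EL_sets. D \<subseteq> E \<and> M \<inter> D \<noteq> {} \<and> card_continuum (restrict_family \<F> D))) \<longrightarrow>
            (\<exists>D\<in>EL_sets. M \<inter> D \<noteq> {} \<and> card_continuum (restrict_family \<F> D) \<and>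
               (\<exists>\<F>'\<subseteq>\<F>. \<Union>(restrict_family \<F>' D) \<notin> CR_sets)))"
proof (intro conjI allI impI)
  fix \<T> K A \<F>
  assume hyp: "(\<T>, K) \<in> {(sacks_trees, {0, 1}), (laver_trees, UNIV)} \<and>
    A \<subseteq> (UNIV \<rightarrow> K) \<and> A \<notin> t0_sets \<T> K \<and>
    point_finite_cover \<F> A \<and> \<F> \<subseteq> t0_sets \<T> K \<and>
    (\<forall>T\<in>\<T>. A \<inter> paths K T \<noteq> {} \<longrightarrow>
       (\<exists>Q\<in>\<T>. Q \<subseteq> T \<and> A \<inter> paths K Q \<noteq> {} \<and>
          card_continuum (restrict_family \<F> (paths K Q))))"
  then have "\<T> = sacks_trees \<and> K = {0, 1} \<or> \<T> = laver_trees \<and> K = UNIV"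
    by simp
  then have "point_catching \<T> (paths K)"
    using point_catching_sacks point_catching_laver by (elim disjE conjE) simp_all
  then show "\<exists>Q\<in>\<T>. A \<inter> paths K Q \<noteq> {} \<and> card_continuum (restrict_family \<F> (paths K Q)) \<and>
    (\<exists>\<F>'\<subseteq>\<F>. \<Union>(restrict_family \<F>' (paths K Q)) \<notin> t_sets \<T> K)"
    by (rule non_t_set_subfamily) (insert hyp, elim conjE, assumption)+
next
  fix M \<F>
  assume hyp: "M \<subseteq> inf_subsets UNIV \<and> M \<notin> NR_sets \<and>
    point_finite_cover \<F> M \<and> \<F> \<subseteq> NR_sets \<and>
    (\<forall>E\<in>EL_sets. M \<inter> E \<noteq> {} \<longrightarrow>
       (\<exists>D\<in>EL_sets. D \<subseteq> E \<and> M \<inter> D \<noteq> {} \<and> card_continuum (restrict_family \<F> D)))"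
  show "\<exists>D\<in>EL_sets. M \<inter> D \<noteq> {} \<and> card_continuum (restrict_family \<F> D) \<and>
    (\<exists>\<F>'\<subseteq>\<F>. \<Union>(restrict_family \<F>' D) \<notin> CR_sets)"
    by (rule non_CR_set_subfamily) (insert hyp, elim conjE, assumption)+
qed

end
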